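(* Let $d\ge2$, let $\psi:[0,\infty)\to(0,1]$ be a strict $d$-monotone Archimedean generator that is continuously differentiable on $(0,\infty)$, with $K_\psi:=\sup_{t>0}t|\psi'(t)|<\infty$. Let $F_k=e^{-V_k}$, $k=1,2$, be $d$-dimensional max-stable distribution functions with unit-Fréchet margins, let $\ell_k(z)=V_k(1/z)$ be their stable tail dependence functions, and let $C_k$ be the Archimax copulas $$C_k(u)=\psi\Bigl(\ell_k\bigl(\psi^{-1}(u_1),\dots,\psi^{-1}(u_d)\bigr)\Bigr),\qquad u\in(0,1]^d,\quad k=1,2.$$ If $V_k(x)=\sum_{i=1}^dx_i^{-1}\Psi_i^{(k)}(x)$, $x\in(0,\infty)^d$, is a $\Psi$-decomposition of $V_k$ for $k=1,2$, then $$\mathrm d_K(C_1,C_2)\le K_\psi\sup_{\substack{x\in(0,\infty)^d\\ \min_ix_i=1}}\left|\sum_{i=1}^d\frac1{x_i}\bigl(\Psi_i^{(1)}(x)-\Psi_i^{(2)}(x)\bigr)\right|.$$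
   Context: For copulas, $\mathrm d_K(C_1,C_2)=\sup_{u\in[0,1]^d}|C_1(u)-C_2(u)|$ (the $C_k$ are extended to $[0,1]^d$ by continuity). Strict $d$-monotone Archimedean generator: $\psi$ is strictly decreasing with $\psi(0)=1$, $\lim_{t\to\infty}\psi(t)=0$, it is differentiable up to order $d-2$ on $(0,\infty)$ with $(-1)^m\psi^{(m)}(t)\ge0$ for $m=0,\dots,d-2$, and $(-1)^{d-2}\psi^{(d-2)}$ is nonincreasing and convex. A $d$-dimensional max-stable distribution function $F$ with unit-Fréchet margins (each margin is $x\mapsto e^{-1/x}$, $x>0$) has the form $F(x)=e^{-V(x)}$ for $x\in(0,\infty)^d$, where $V(x)=\mathbb{E}\{\max_{1\le j\le d}Z_j/x_j\}$ for some random vector $Z$ with values in $[0,\infty)^d$ with $\mathbb{E}\{Z_j\}=1$ for all $j$ and $\mathbb{P}\{\max_jZ_j>0\}=1$ (a de Haan representer). The stable tail dependence function is $\ell(z)=V(1/z)=\mathbb{E}\{\max_jz_jZ_j\}$, $z\in[0,\infty)^d$ (with $1/z$ componentwise and $1/0=+\infty$). $\Psi$-decomposition: functions $\Psi_i(x)=\mathbb{E}\{Z_iW_i(x,Z)\}$, where $Z$ is a de Haan representer and $W=(W_1,\dots,W_d):(0,\infty)^d\times[0,\infty)^d\to\{w\in[0,1]^d:\sum_iw_i=1\}$ is a Borel map with $W_i(cx,z)=W_i(x,z)$ for $c>0$ and such that $W_i(x,z)>0$ implies $i\in\arg\max_jz_j/x_j$; one then has $V(x)=\sum_ix_i^{-1}\Psi_i(x)$.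 *)

theory Defs
  imports "HOL-Probability.Probability"
begin

text \<open>Continuity of \<open>\<psi>\<close> on \<open>[0,\<infinity>)\<close> is part of the usual notion of a generator; without it \<open>\<psi>\<close> could
  jump at 0 and would have no inverse on \<open>(0,1]\<close>.\<close>

definition strict_archimedean_generator :: "nat \<Rightarrow> (real \<Rightarrow> real) \<Rightarrow> bool" where
  "strict_archimedean_generator d \<psi> \<longleftrightarrow>
     strict_antimono_on {0..} \<psi> \<and> \<psi> 0 = 1 \<and> (\<psi> \<longlongrightarrow> 0) at_top \<and> continuous_on {0..} \<psi> \<and>
     (\<forall>m < d - 2. \<forall>t > 0. ((deriv ^^ m) \<psi>) differentiable (at t)) \<and>
     (\<forall>m \<le> d - 2. \<forall>t > 0. (- 1) ^ m * (deriv ^^ m) \<psi> t \<ge> 0) \<and>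
     antimono_on {0<..} (\<lambda>t. (- 1) ^ (d - 2) * (deriv ^^ (d - 2)) \<psi> t) \<and>
     convex_on {0<..} (\<lambda>t. (- 1) ^ (d - 2) * (deriv ^^ (d - 2)) \<psi> t)"

definition max_stable :: "(real ^ 'd \<Rightarrow> real) \<Rightarrow> bool" where
  "max_stable F \<longleftrightarrow>
     (\<forall>n::nat. n \<ge> 1 \<longrightarrow> (\<exists>a b :: real ^ 'd. (\<forall>i. a $ i > 0) \<and>
        (\<forall>x. F (\<chi> i. a $ i * x $ i + b $ i) ^ n = F x)))"

text \<open>In \<open>{..x}\<close> the order on \<open>real ^ 'd\<close> is componentwise, so \<open>F\<close> is the joint distribution
  function of \<open>\<mu>\<close>.\<close>

definition max_stable_unit_frechet :: "(real ^ 'd \<Rightarrow> real) \<Rightarrow> bool" where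
  "max_stable_unit_frechet F \<longleftrightarrow>
     (\<exists>\<mu>. prob_space \<mu> \<and> sets \<mu> = sets borel \<and> (\<forall>x. F x = measure \<mu> {..x}) \<and>
        (\<forall>j. \<forall>t > 0. cdf (distr \<mu> borel (\<lambda>y. y $ j)) t = exp (- 1 / t))) \<and>
     max_stable F"

text \<open>The argument of \<open>V\<close> ranges over \<open>(0,\<infinity>]\<^sup>d\<close>, so that \<open>V (1/z)\<close> makes sense for \<open>z\<close> in \<open>[0,\<infinity>)\<^sup>d\<close>;
  in \<open>ereal\<close> one has \<open>1 / 0 = \<infinity>\<close> and \<open>r / \<infinity> = 0\<close> for real \<open>r\<close>.\<close>

definition de_haan_representer ::
    "'a measure \<Rightarrow> ('a \<Rightarrow> real ^ 'd) \<Rightarrow> (ereal ^ 'd \<Rightarrow> real) \<Rightarrow> bool" where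
  "de_haan_representer M Z V \<longleftrightarrow>
     prob_space M \<and> Z \<in> borel_measurable M \<and>
     (\<forall>\<omega> \<in> space M. \<forall>j. Z \<omega> $ j \<ge> 0) \<and>
     (\<forall>j. prob_space.expectation M (\<lambda>\<omega>. Z \<omega> $ j) = 1) \<and>
     prob_space.prob M {\<omega> \<in> space M. (MAX j. Z \<omega> $ j) > 0} = 1 \<and>
     (\<forall>x. (\<forall>i. x $ i > 0) \<longrightarrow>
        V x = prob_space.expectation M (\<lambda>\<omega>. MAX j. real_of_ereal (ereal (Z \<omega> $ j) / x $ j)))"

definition Psi_decomposition ::
    "'a measure \<Rightarrow> ('a \<Rightarrow> real ^ 'd) \<Rightarrow> (real ^ 'd \<Rightarrow> real ^ 'd \<Rightarrow> real ^ 'd) \<Rightarrow>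
     (ereal ^ 'd \<Rightarrow> real) \<Rightarrow> ('d \<Rightarrow> real ^ 'd \<Rightarrow> real) \<Rightarrow> bool" where
  "Psi_decomposition M Z W V \<Psi> \<longleftrightarrow>
     de_haan_representer M Z V \<and>
     (\<lambda>(x, z). W x z) \<in>
       borel_measurable (restrict_space borel ({x. \<forall>i. x $ i > 0} \<times> {z. \<forall>i. z $ i \<ge> 0})) \<and>
     (\<forall>x z. (\<forall>i. x $ i > 0) \<longrightarrow> (\<forall>i. z $ i \<ge> 0) \<longrightarrow>
        (\<forall>i. W x z $ i \<in> {0..1}) \<and> (\<Sum>i\<in>UNIV. W x z $ i) = 1 \<and>
        (\<forall>c > 0. W (c *\<^sub>R x) z = W x z) \<and>
        (\<forall>i. W x z $ i > 0 \<longrightarrow> is_arg_max (\<lambda>j. z $ j / x $ j) (\<lambda>_. True) i)) \<and>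
     (\<forall>i x. (\<forall>j. x $ j > 0) \<longrightarrow>
        \<Psi> i x = prob_space.expectation M (\<lambda>\<omega>. Z \<omega> $ i * W x (Z \<omega>) $ i))"

definition stable_tail_dependence :: "(ereal ^ 'd \<Rightarrow> real) \<Rightarrow> real ^ 'd \<Rightarrow> real" where
  "stable_tail_dependence V z = V (\<chi> i. 1 / ereal (z $ i))"

text \<open>The closed formula on \<open>(0,1]\<^sup>d\<close>, extended to \<open>[0,1]\<^sup>d\<close> by continuity.\<close>

definition archimax_copula :: "(real \<Rightarrow> real) \<Rightarrow> (real ^ 'd \<Rightarrow> real) \<Rightarrow> real ^ 'd \<Rightarrow> real" where
  "archimax_copula \<psi> L u =
     (let C = (\<lambda>v. \<psi> (L (\<chi> i. the_inv_into {0..} \<psi> (v $ i)))) in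
      if \<forall>i. u $ i > 0 then C u
      else Lim (at u within {v. \<forall>i. v $ i \<in> {0<..1}}) C)"

definition kolmogorov_dist :: "(real ^ 'd \<Rightarrow> real) \<Rightarrow> (real ^ 'd \<Rightarrow> real) \<Rightarrow> real" where
  "kolmogorov_dist C\<^sub>1 C\<^sub>2 = (SUP u \<in> {u. \<forall>i. u $ i \<in> {0..1}}. \<bar>C\<^sub>1 u - C\<^sub>2 u\<bar>)"

text \<open>Consistency checks: the two formulas that come with a stable tail dependence function and with
  a decomposition are consequences of the definitions, so they need not be assumed.\<close>

lemma stable_tail_dependence_eq:
  assumes "de_haan_representer M Z V" "\<forall>i. z $ i \<ge> 0"
  shows "stable_tail_dependence V z = prob_space.expectation M (\<lambda>\<omega>. MAX j. z $ j * Z \<omega> $ j)"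
proof -
  have pos: "1 / ereal (z $ i) > 0" for i
    using assms(2)
    by (cases "z $ i = 0") (auto simp: one_ereal_def zero_ereal_def less_le)
  have "real_of_ereal (ereal r / (1 / ereal (z $ j))) = z $ j * r" for r j
    by (cases "z $ j = 0") (auto simp: one_ereal_def zero_ereal_def)
  then show ?thesis
    using assms(1) pos unfolding de_haan_representer_def stable_tail_dependence_def by simp
qed

lemma Psi_decomposition_sum:
  fixes V :: "ereal ^ 'd \<Rightarrow> real"
  assumes "Psi_decomposition M Z W V \<Psi>" "\<forall>i. x $ i > 0"
  shows "V (\<chi> i. ereal (x $ i)) = (\<Sum>i\<in>UNIV. 1 / x $ i * \<Psi> i x)"
proof -
  let ?P = "{x::real^'d. \<forall>i. x $ i > 0}" and ?N = "{z::real^'d. \<forall>i. z $ i \<ge> 0}"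
  have rep: "de_haan_representer M Z V"
    and Wm: "(\<lambda>(x, z). W x z) \<in> borel_measurable (restrict_space borel (?P \<times> ?N))"
    using assms(1) unfolding Psi_decomposition_def by auto
  have Wz: "(\<forall>i. W x z $ i \<in> {0..1})" "(\<Sum>i\<in>UNIV. W x z $ i) = 1"
    "\<And>i. W x z $ i > 0 \<Longrightarrow> is_arg_max (\<lambda>j. z $ j / x $ j) (\<lambda>_. True) i"
    if "\<forall>i. z $ i \<ge> 0" for z
    using assms that unfolding Psi_decomposition_def by auto
  have Psi: "\<Psi> i x = integral\<^sup>L M (\<lambda>\<omega>. Z \<omega> $ i * W x (Z \<omega>) $ i)" for i
    using assms unfolding Psi_decomposition_def by auto
  interpret prob_space M using rep unfolding de_haan_representer_def by auto
  have Zm [measurable]: "Z \<in> borel_measurable M" and Zn: "\<And>\<omega> j. \<omega> \<in> space M \<Longrightarrow> Z \<omega> $ j \<ge> 0"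
    and Ze: "\<And>j. expectation (\<lambda>\<omega>. Z \<omega> $ j) = 1"
    using rep unfolding de_haan_representer_def by auto
  have Vx: "V (\<chi> i. ereal (x $ i)) = expectation (\<lambda>\<omega>. MAX j. Z \<omega> $ j / x $ j)"
    using rep assms(2) unfolding de_haan_representer_def by (simp add: less_imp_neq[symmetric])
  have "(\<lambda>\<omega>. (x, Z \<omega>)) \<in> measurable M (restrict_space borel (?P \<times> ?N))"
    using assms(2) Zn by (intro measurable_restrict_space2) (auto simp: borel_prod[symmetric])
  from measurable_compose[OF this Wm]
  have WZm [measurable]: "(\<lambda>\<omega>. W x (Z \<omega>)) \<in> borel_measurable M" by simp
  have comp: "(\<lambda>y::real^'d. y $ i) \<in> borel_measurable borel" for i
    by (intro borel_measurable_continuous_onI continuous_intros)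
  note [measurable] = measurable_compose[OF Zm comp] measurable_compose[OF WZm comp]
  have int: "integrable M (\<lambda>\<omega>. Z \<omega> $ i * W x (Z \<omega>) $ i)" for i
  proof (rule Bochner_Integration.integrable_bound)
    show "integrable M (\<lambda>\<omega>. Z \<omega> $ i)"
      using Ze[of i] not_integrable_integral_eq by fastforce
    show "AE \<omega> in M. norm (Z \<omega> $ i * W x (Z \<omega>) $ i) \<le> norm (Z \<omega> $ i)"
      using Wz(1) Zn by (intro AE_I2) (auto simp: abs_mult intro!: mult_left_le)
  qed simp
  have "(MAX j. Z \<omega> $ j / x $ j) = (\<Sum>i\<in>UNIV. 1 / x $ i * (Z \<omega> $ i * W x (Z \<omega>) $ i))"
    if "\<omega> \<in> space M" for \<omega>
  proof -
    let ?m = "MAX j. Z \<omega> $ j / x $ j"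
    have "1 / x $ i * (Z \<omega> $ i * W x (Z \<omega>) $ i) = ?m * W x (Z \<omega>) $ i" for i
    proof (cases "W x (Z \<omega>) $ i > 0")
      case True
      then have "\<And>j. Z \<omega> $ j / x $ j \<le> Z \<omega> $ i / x $ i"
        using Wz(3) Zn that by (fastforce simp: is_arg_max_linorder)
      then have "?m = Z \<omega> $ i / x $ i" by (intro Max_eqI) auto
      then show ?thesis by simp
    next
      case False
      then have "W x (Z \<omega>) $ i = 0"
        using Wz(1)[of "Z \<omega>"] Zn[OF that] by (auto simp: less_eq_real_def)
      then show ?thesis by simp
    qed
    then show ?thesis
      using Wz(2)[of "Z \<omega>"] Zn[OF that] by (simp flip: sum_distrib_left)
  qed
  then have "V (\<chi> i. ereal (x $ i))
      = expectation (\<lambda>\<omega>. \<Sum>i\<in>UNIV. 1 / x $ i * (Z \<omega> $ i * W x (Z \<omega>) $ i))"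
    unfolding Vx by (intro Bochner_Integration.integral_cong) auto
  also have "\<dots> = (\<Sum>i\<in>UNIV. 1 / x $ i * \<Psi> i x)"
    unfolding Psi
    by (subst Bochner_Integration.integral_sum)
      (use int in \<open>auto intro!: integrable_mult_right simp del: times_divide_eq_left\<close>)
  finally show ?thesis .
qed

end

theory Submission
  imports Defs
begin

text \<open>
  By the given decompositions, the supremum \<open>S\<close> on the right-hand side is the supremum of
  \<open>\<bar>V\<^sub>1 x - V\<^sub>2 x\<bar>\<close> over the \<open>x\<close> with minimum \<open>1\<close>. Substituting \<open>x = 1 / z\<close> turns it into the
  supremum of \<open>\<bar>\<ell>\<^sub>1 z - \<ell>\<^sub>2 z\<bar>\<close> over the \<open>z\<close> with positive coordinates and maximum \<open>1\<close>. Stable tail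
  dependence functions are homogeneous of degree one and continuous, so
  \<open>\<bar>\<ell>\<^sub>1 z - \<ell>\<^sub>2 z\<bar> \<le> m S\<close> with \<open>m = max\<^sub>i z\<^sub>i\<close> for all \<open>z\<close> in the closed orthant
  (\<open>stable_tail_dependence_diff_le\<close>).

  Both \<open>\<ell>\<^sub>1 z\<close> and \<open>\<ell>\<^sub>2 z\<close> are at least \<open>m\<close>, and for \<open>t \<ge> m\<close> one has \<open>\<bar>\<psi>' t\<bar> \<le> K / t \<le> K / m\<close>, where
  \<open>K\<close> is the supremum of \<open>t \<bar>\<psi>' t\<bar>\<close>. For \<open>m > 0\<close> the mean value theorem thus gives
  \<open>\<bar>\<psi> (\<ell>\<^sub>1 z) - \<psi> (\<ell>\<^sub>2 z)\<bar> \<le> K S\<close>: the two factors \<open>m\<close> cancel (\<open>diff_le_of_scaled_deriv_bound\<close>). For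
  \<open>m = 0\<close> both \<open>\<ell>\<^sub>1 z\<close> and \<open>\<ell>\<^sub>2 z\<close> vanish. With
  \<open>z\<^sub>i = \<psi>\<^sup>-\<^sup>1 u\<^sub>i\<close> this is the claim at all \<open>u\<close> with positive coordinates. At the remaining points of
  the unit cube both copulas vanish (\<open>archimax_copula_eq_0\<close>).
\<close>

section \<open>Bounds for stable tail dependence functions\<close>

lemma de_haan_integrable:
  assumes "de_haan_representer M Z V"
  shows "integrable M (\<lambda>\<omega>. Z \<omega> $ j)"
proof (rule ccontr)
  assume "\<not> ?thesis"
  then have "integral\<^sup>L M (\<lambda>\<omega>. Z \<omega> $ j) = 0"
    by (rule not_integrable_integral_eq)
  then show False
    using assms unfolding de_haan_representer_def by auto
qed

lemma de_haan_integrable_Max: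
  fixes Z :: "'a \<Rightarrow> real ^ 'd"
  assumes "de_haan_representer M Z V"
  shows "integrable M (\<lambda>\<omega>. MAX j. z $ j * Z \<omega> $ j)"
  using de_haan_integrable[OF assms] by (intro integrable_MAX integrable_mult_right) auto

lemma stable_tail_dependence_ge_component:
  fixes Z :: "'a \<Rightarrow> real ^ 'd"
  assumes rep: "de_haan_representer M Z V" and z: "\<forall>i. z $ i \<ge> 0"
  shows "z $ i \<le> stable_tail_dependence V z"
proof -
  have "z $ i = integral\<^sup>L M (\<lambda>\<omega>. z $ i * Z \<omega> $ i)"
    using rep unfolding de_haan_representer_def by simp
  also have "\<dots> \<le> integral\<^sup>L M (\<lambda>\<omega>. MAX j. z $ j * Z \<omega> $ j)"
    using de_haan_integrable[OF rep] de_haan_integrable_Max[OF rep]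
    by (intro integral_mono) auto
  finally show ?thesis
    using stable_tail_dependence_eq[OF rep z] by simp
qed

lemma stable_tail_dependence_scaleR:
  fixes Z :: "'a \<Rightarrow> real ^ 'd"
  assumes rep: "de_haan_representer M Z V" and z: "\<forall>i. z $ i \<ge> 0" and c: "c \<ge> 0"
  shows "stable_tail_dependence V (c *\<^sub>R z) = c * stable_tail_dependence V z"
proof -
  have "(MAX j. (c *\<^sub>R z) $ j * Z \<omega> $ j) = c * (MAX j. z $ j * Z \<omega> $ j)" for \<omega>
  proof -
    have "mono (\<lambda>y::real. c * y)"
      using c by (simp add: mono_def mult_left_mono)
    from mono_Max_commute[OF this, of "range (\<lambda>j. z $ j * Z \<omega> $ j)"]
    show ?thesis by (simp add: image_image mult.assoc)
  qed
  moreover have "\<forall>i. (c *\<^sub>R z) $ i \<ge> 0"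
    using z c by simp
  ultimately show ?thesis
    using stable_tail_dependence_eq[OF rep] z by simp
qed

text \<open>The Lipschitz bound holds since the increase of the maximum is at most the sum of the increases
  of its arguments, and each \<open>Z\<^sub>i\<close> has expectation one.\<close>

lemma stable_tail_dependence_mono_Lipschitz:
  fixes Z :: "'a \<Rightarrow> real ^ 'd"
  assumes rep: "de_haan_representer M Z V" and z: "\<forall>i. z $ i \<ge> 0" and zy: "\<forall>i. z $ i \<le> y $ i"
  shows "stable_tail_dependence V z \<le> stable_tail_dependence V y"
    and "stable_tail_dependence V y \<le> stable_tail_dependence V z + (\<Sum>i\<in>UNIV. y $ i - z $ i)"
proof -
  have y: "\<forall>i. y $ i \<ge> 0"
    using z zy by (meson order_trans)
  have nn: "Z \<omega> $ j \<ge> 0" if "\<omega> \<in> space M" for \<omega> j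
    using rep that unfolding de_haan_representer_def by auto
  have E: "integral\<^sup>L M (\<lambda>\<omega>. Z \<omega> $ j) = 1" for j
    using rep unfolding de_haan_representer_def by auto
  note int = de_haan_integrable[OF rep] de_haan_integrable_Max[OF rep]
  have "(MAX j. z $ j * Z \<omega> $ j) \<le> (MAX j. y $ j * Z \<omega> $ j)" if "\<omega> \<in> space M" for \<omega>
  proof -
    have "z $ i * Z \<omega> $ i \<le> (MAX j. y $ j * Z \<omega> $ j)" for i
    proof -
      have "z $ i * Z \<omega> $ i \<le> y $ i * Z \<omega> $ i"
        using zy nn[OF that] by (simp add: mult_right_mono)
      also have "\<dots> \<le> (MAX j. y $ j * Z \<omega> $ j)"
        by (intro Max_ge) auto
      finally show ?thesis .
    qed
    then show ?thesis by simp
  qed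
  then show "stable_tail_dependence V z \<le> stable_tail_dependence V y"
    unfolding stable_tail_dependence_eq[OF rep z] stable_tail_dependence_eq[OF rep y]
    by (intro integral_mono int)
  have "(MAX j. y $ j * Z \<omega> $ j)
      \<le> (MAX j. z $ j * Z \<omega> $ j) + (\<Sum>i\<in>UNIV. (y $ i - z $ i) * Z \<omega> $ i)"
    if "\<omega> \<in> space M" for \<omega>
  proof -
    have "y $ j * Z \<omega> $ j
        \<le> (MAX j. z $ j * Z \<omega> $ j) + (\<Sum>i\<in>UNIV. (y $ i - z $ i) * Z \<omega> $ i)" for j
    proof -
      have "z $ j * Z \<omega> $ j \<le> (MAX j. z $ j * Z \<omega> $ j)"
        by (intro Max_ge) auto
      moreover have "(y $ j - z $ j) * Z \<omega> $ j \<le> (\<Sum>i\<in>UNIV. (y $ i - z $ i) * Z \<omega> $ i)"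
        using zy nn[OF that] by (intro member_le_sum) auto
      moreover have "y $ j * Z \<omega> $ j = z $ j * Z \<omega> $ j + (y $ j - z $ j) * Z \<omega> $ j"
        by (simp add: left_diff_distrib)
      ultimately show ?thesis
        by linarith
    qed
    then show ?thesis by simp
  qed
  then have "integral\<^sup>L M (\<lambda>\<omega>. MAX j. y $ j * Z \<omega> $ j)
      \<le> integral\<^sup>L M (\<lambda>\<omega>. (MAX j. z $ j * Z \<omega> $ j) + (\<Sum>i\<in>UNIV. (y $ i - z $ i) * Z \<omega> $ i))"
    by (intro integral_mono int Bochner_Integration.integrable_add
        Bochner_Integration.integrable_sum integrable_mult_right)
  also have "\<dots> = integral\<^sup>L M (\<lambda>\<omega>. MAX j. z $ j * Z \<omega> $ j) + (\<Sum>i\<in>UNIV. y $ i - z $ i)"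
    using int by (simp add: E)
  finally show "stable_tail_dependence V y
      \<le> stable_tail_dependence V z + (\<Sum>i\<in>UNIV. y $ i - z $ i)"
    unfolding stable_tail_dependence_eq[OF rep z] stable_tail_dependence_eq[OF rep y] .
qed

lemma stable_tail_dependence_zero:
  fixes Z :: "'a \<Rightarrow> real ^ 'd"
  assumes rep: "de_haan_representer M Z V"
  shows "stable_tail_dependence V 0 = 0"
  using stable_tail_dependence_scaleR[OF rep, of 0 0] by simp

lemma stable_tail_dependence_le_sum:
  fixes Z :: "'a \<Rightarrow> real ^ 'd"
  assumes rep: "de_haan_representer M Z V" and z: "\<forall>i. z $ i \<ge> 0"
  shows "stable_tail_dependence V z \<le> (\<Sum>i\<in>UNIV. z $ i)"
  using stable_tail_dependence_mono_Lipschitz(2)[OF rep, of 0 z] z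
  by (simp add: stable_tail_dependence_zero[OF rep])

lemma Psi_sum_eq_stable_tail_dependence:
  fixes V :: "ereal ^ 'd \<Rightarrow> real"
  assumes "Psi_decomposition M Z W V \<Psi>" and x: "\<forall>i. x $ i > 0"
  shows "(\<Sum>i\<in>UNIV. 1 / x $ i * \<Psi> i x) = stable_tail_dependence V (\<chi> i. 1 / x $ i)"
proof -
  have "1 / ereal (1 / x $ i) = ereal (x $ i)" for i
    using x[rule_format, of i] by (simp add: one_ereal_def)
  then show ?thesis
    unfolding Psi_decomposition_sum[OF assms, symmetric] stable_tail_dependence_def by simp
qed

text \<open>By homogeneity, a bound for the difference of two stable tail dependence functions on the
  positive part of the unit sphere of the maximum norm extends to all positive arguments, and by
  continuity to the whole orthant.\<close>

lemma stable_tail_dependence_diff_le: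
  fixes Z\<^sub>1 :: "'a \<Rightarrow> real ^ 'd" and Z\<^sub>2 :: "'b \<Rightarrow> real ^ 'd"
  assumes rep\<^sub>1: "de_haan_representer M\<^sub>1 Z\<^sub>1 V\<^sub>1" and rep\<^sub>2: "de_haan_representer M\<^sub>2 Z\<^sub>2 V\<^sub>2"
    and S: "\<And>y. (\<forall>i. y $ i > 0) \<Longrightarrow> (MAX i. y $ i) = 1 \<Longrightarrow>
      \<bar>stable_tail_dependence V\<^sub>1 y - stable_tail_dependence V\<^sub>2 y\<bar> \<le> S"
    and z: "\<forall>i. z $ i \<ge> 0"
  shows "\<bar>stable_tail_dependence V\<^sub>1 z - stable_tail_dependence V\<^sub>2 z\<bar> \<le> (MAX i. z $ i) * S"
proof -
  let ?l\<^sub>1 = "stable_tail_dependence V\<^sub>1" and ?l\<^sub>2 = "stable_tail_dependence V\<^sub>2"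
  have pos: "\<bar>?l\<^sub>1 y - ?l\<^sub>2 y\<bar> \<le> (MAX i. y $ i) * S" if y: "\<forall>i. y $ i > 0" for y
  proof -
    let ?m = "MAX i. y $ i"
    have m: "?m > 0"
      using y by (auto simp: Max_gr_iff)
    have y': "\<forall>i. y $ i \<ge> 0"
      using y less_imp_le by blast
    have "mono (\<lambda>t::real. t / ?m)"
      using m by (simp add: mono_def divide_right_mono)
    from mono_Max_commute[OF this, of "range (\<lambda>i. y $ i)"]
    have "(MAX i. y $ i / ?m) = ?m / ?m"
      by (simp add: image_image)
    then have "(MAX i. ((1 / ?m) *\<^sub>R y) $ i) = 1"
      using m by simp
    moreover have "\<forall>i. ((1 / ?m) *\<^sub>R y) $ i > 0"
      using m y by simp
    ultimately have "\<bar>?l\<^sub>1 ((1 / ?m) *\<^sub>R y) - ?l\<^sub>2 ((1 / ?m) *\<^sub>R y)\<bar> \<le> S"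
      by (intro S)
    also have "?l\<^sub>1 ((1 / ?m) *\<^sub>R y) - ?l\<^sub>2 ((1 / ?m) *\<^sub>R y) = (?l\<^sub>1 y - ?l\<^sub>2 y) / ?m"
      using m y' stable_tail_dependence_scaleR[OF rep\<^sub>1, of y "1 / ?m"]
        stable_tail_dependence_scaleR[OF rep\<^sub>2, of y "1 / ?m"]
      by (simp add: diff_divide_distrib)
    finally show ?thesis
      using m by (simp add: divide_le_eq mult.commute)
  qed
  let ?m = "MAX i. z $ i" and ?d = "real CARD('d)"
  have bound: "\<bar>?l\<^sub>1 z - ?l\<^sub>2 z\<bar> \<le> (?m + e) * S + ?d * e" if e: "e > 0" for e
  proof -
    \<comment> \<open>Shifting every coordinate by \<open>e\<close> moves \<open>z\<close> into the open orthant.\<close>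
    define y where "y = (\<chi> i. z $ i + e)"
    have y: "\<forall>i. y $ i > 0" and zy: "\<forall>i. z $ i \<le> y $ i"
      using z e by (auto simp: y_def add_nonneg_pos)
    have sum: "(\<Sum>i\<in>UNIV. y $ i - z $ i) = ?d * e"
      by (simp add: y_def)
    have "mono (\<lambda>t::real. t + e)"
      by (simp add: mono_def)
    from mono_Max_commute[OF this, of "range (\<lambda>i. z $ i)"]
    have "(MAX i. y $ i) = ?m + e"
      by (simp add: image_image y_def)
    with pos[OF y] have "\<bar>?l\<^sub>1 y - ?l\<^sub>2 y\<bar> \<le> (?m + e) * S"
      by simp
    with stable_tail_dependence_mono_Lipschitz[OF rep\<^sub>1 z zy]
      stable_tail_dependence_mono_Lipschitz[OF rep\<^sub>2 z zy]
    show ?thesis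
      unfolding sum by linarith
  qed
  have "((\<lambda>e. (?m + e) * S + ?d * e) \<longlongrightarrow> (?m + 0) * S + ?d * 0) (at_right 0)"
    by (intro tendsto_intros)
  moreover have "\<forall>\<^sub>F e in at_right 0. \<bar>?l\<^sub>1 z - ?l\<^sub>2 z\<bar> \<le> (?m + e) * S + ?d * e"
    using bound by (auto simp: eventually_at_right_field intro: exI[of _ 1])
  ultimately show ?thesis
    using tendsto_lowerbound[OF _ _ trivial_limit_at_right_real] by fastforce
qed

section \<open>The generator\<close>

text \<open>The mean value theorem gives an intermediate point, which is at least \<open>m\<close>, so that the derivative
  there is at most \<open>K / m\<close> in absolute value.\<close>

lemma diff_le_of_scaled_deriv_bound:
  fixes f :: "real \<Rightarrow> real"
  assumes diff: "\<And>t. t > 0 \<Longrightarrow> f differentiable (at t)"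
    and K: "\<And>t. t > 0 \<Longrightarrow> t * \<bar>deriv f t\<bar> \<le> K"
    and m: "0 < m" "m \<le> a" "m \<le> b" and ab: "\<bar>a - b\<bar> \<le> m * S"
  shows "\<bar>f a - f b\<bar> \<le> K * S"
proof -
  have le: "\<bar>f a - f b\<bar> \<le> K * S" if "m \<le> a" "a < b" "\<bar>a - b\<bar> \<le> m * S" for a b
  proof -
    have der: "(f has_real_derivative deriv f t) (at t)" if "t > 0" for t
      using diff[OF that] by (simp add: DERIV_deriv_iff_real_differentiable)
    have "\<exists>t>a. t < b \<and> f b - f a = (b - a) * deriv f t"
      using der m(1) that by (intro MVT2) auto
    then obtain t where t: "a < t" "t < b" "f b - f a = (b - a) * deriv f t"
      by blast
    have "\<bar>f a - f b\<bar> = \<bar>a - b\<bar> * \<bar>deriv f t\<bar>"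
      using t(3) by (metis abs_minus_commute abs_mult)
    also have "\<dots> \<le> (m * S) * \<bar>deriv f t\<bar>"
      using that by (intro mult_right_mono) auto
    also have "\<dots> = S * (m * \<bar>deriv f t\<bar>)"
      by simp
    also have "\<dots> \<le> S * K"
    proof (intro mult_left_mono)
      have "m * \<bar>deriv f t\<bar> \<le> t * \<bar>deriv f t\<bar>"
        using t that by (intro mult_right_mono) auto
      then show "m * \<bar>deriv f t\<bar> \<le> K"
        using K[of t] t that m by linarith
      have "0 \<le> m * S" using that by linarith
      then show "0 \<le> S" using m by (simp add: zero_le_mult_iff)
    qed
    finally show ?thesis by (simp add: mult.commute)
  qed
  consider "a < b" | "b < a" | "a = b" by linarith
  then show ?thesis
  proof cases
    case 1
    then show ?thesis using le[of a b] m ab by blast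
  next
    case 2
    then show ?thesis using le[of b a] m ab by (simp add: abs_minus_commute)
  next
    case 3
    have "0 \<le> S" using ab m 3 by (simp add: zero_le_mult_iff)
    moreover have "0 \<le> K" using K[of 1] by simp
    ultimately show ?thesis using 3 by simp
  qed
qed

lemma strict_archimedean_generator_bij_betw:
  assumes gen: "strict_archimedean_generator d \<psi>" and range: "\<psi> \<in> {0..} \<rightarrow> {0<..1}"
  shows "bij_betw \<psi> {0..} {0<..1}"
proof -
  have anti: "strict_antimono_on {0..} \<psi>" and \<psi>0: "\<psi> 0 = 1" and lim: "(\<psi> \<longlongrightarrow> 0) at_top"
    and cont: "continuous_on {0..} \<psi>"
    using gen unfolding strict_archimedean_generator_def by auto
  have "inj_on \<psi> {0..}"
  proof (rule inj_onI)
    fix s t :: real assume "s \<in> {0..}" "t \<in> {0..}" "\<psi> s = \<psi> t"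
    then show "s = t"
      using monotone_onD[OF anti, of s t] monotone_onD[OF anti, of t s]
      by (cases s t rule: linorder_cases) auto
  qed
  moreover have "v \<in> \<psi> ` {0..}" if "v \<in> {0<..1}" for v
  proof -
    have "\<forall>\<^sub>F t in at_top. \<psi> t < v"
      using lim that by (intro order_tendstoD) auto
    with eventually_ge_at_top[of 0] have "\<forall>\<^sub>F t in at_top. t \<ge> 0 \<and> \<psi> t < v"
      by (rule eventually_conj)
    then obtain b where b: "b \<ge> 0" "\<psi> b < v"
      by (auto dest: eventually_happens)
    have "\<exists>t\<ge>0. t \<le> b \<and> \<psi> t = v"
      using b that \<psi>0 by (intro IVT2' continuous_on_subset[OF cont]) auto
    then show ?thesis by auto
  qed
  ultimately show ?thesis
    using range by (auto simp: bij_betw_def)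
qed

section \<open>Archimax copulas on the boundary\<close>

text \<open>The value where a coordinate vanishes is a limit from the half-open cube. There the copula is
  at most each of its arguments, because \<open>L\<close> dominates every coordinate and \<open>\<psi>\<close> decreases. The limit
  is determined since such a point is a limit point of the half-open cube.\<close>

lemma archimax_copula_eq_0:
  fixes L :: "real ^ 'd \<Rightarrow> real"
  assumes gen: "strict_archimedean_generator d \<psi>" and range: "\<psi> \<in> {0..} \<rightarrow> {0<..1}"
    and L: "\<And>z i. (\<forall>i. z $ i \<ge> 0) \<Longrightarrow> z $ i \<le> L z"
    and u: "\<forall>i. u $ i \<in> {0..1}" and k: "u $ k = 0"
  shows "archimax_copula \<psi> L u = 0"
proof -
  let ?I = "{v :: real ^ 'd. \<forall>i. v $ i \<in> {0<..1}}"
  let ?C = "\<lambda>v. \<psi> (L (\<chi> i. the_inv_into {0..} \<psi> (v $ i)))"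
  have anti: "strict_antimono_on {0..} \<psi>"
    using gen unfolding strict_archimedean_generator_def by auto
  have anti': "\<psi> t \<le> \<psi> s" if "0 \<le> s" "s \<le> t" for s t
    using anti that by (cases "s = t") (auto simp: monotone_on_def less_imp_le)
  have bij: "bij_betw \<psi> {0..} {0<..1}"
    by (rule strict_archimedean_generator_bij_betw[OF gen range])
  have inv: "the_inv_into {0..} \<psi> w \<ge> 0" "\<psi> (the_inv_into {0..} \<psi> w) = w" if "w \<in> {0<..1}" for w
    using bij_betwE[OF bij_betw_the_inv_into[OF bij]] f_the_inv_into_f_bij_betw[OF bij] that
    by auto
  have C_le: "0 \<le> ?C v \<and> ?C v \<le> v $ k" if "v \<in> ?I" for v
  proof -
    let ?z = "\<chi> i. the_inv_into {0..} \<psi> (v $ i)"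
    have "\<forall>i. ?z $ i \<ge> 0"
      using that inv by simp
    then have le: "?z $ k \<le> L ?z"
      by (rule L)
    moreover have nn: "0 \<le> ?z $ k"
      using that inv by simp
    ultimately have "?C v \<le> \<psi> (?z $ k)"
      using anti' by blast
    also have "\<dots> = v $ k"
      using that inv by simp
    finally have "?C v \<le> v $ k" .
    moreover have "0 \<le> ?C v"
      using range order_trans[OF nn le] by (simp add: Pi_iff less_imp_le)
    ultimately show ?thesis by simp
  qed
  then have ev_ge: "\<forall>\<^sub>F v in at u within ?I. 0 \<le> ?C v"
    and ev_le: "\<forall>\<^sub>F v in at u within ?I. ?C v \<le> v $ k"
    by (simp_all only: eventually_at_filter) (rule always_eventually, blast)+
  have "((\<lambda>v. v $ k) \<longlongrightarrow> u $ k) (at u within ?I)"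
    by (intro tendsto_intros)
  then have "(?C \<longlongrightarrow> 0) (at u within ?I)"
    unfolding k by (intro tendsto_sandwich[OF ev_ge ev_le tendsto_const])
  moreover have "at u within ?I \<noteq> bot"
  proof -
    have "u islimpt ?I"
    proof (rule islimpt_approachable[THEN iffD2], intro allI impI)
      fix e :: real assume e: "e > 0"
      define n where "n = norm (1 - u)"
      define t where "t = min 1 (e / (2 * (n + 1)))"
      have n: "n \<ge> 0" by (simp add: n_def)
      have t: "0 < t" "t \<le> 1" "t * n < e"
      proof -
        show "0 < t" "t \<le> 1" using e n by (auto simp: t_def)
        have "t * n \<le> e / (2 * (n + 1)) * n"
          using n by (intro mult_right_mono) (auto simp: t_def)
        also have "\<dots> < e"
          using e n by (simp add: field_simps add_nonneg_pos)
        finally show "t * n < e" .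
      qed
      \<comment> \<open>A point on the segment from \<open>u\<close> to the corner \<open>(1, ..., 1)\<close>.\<close>
      let ?v = "u + t *\<^sub>R (1 - u)"
      have "?v $ i \<in> {0<..1}" for i
      proof -
        have ui: "0 \<le> u $ i" "u $ i \<le> 1" using u by auto
        have "?v $ i = (1 - t) * u $ i + t"
          by (simp add: algebra_simps)
        moreover have "(1 - t) * u $ i \<ge> 0" "(1 - t) * u $ i \<le> 1 - t"
          using t ui by (auto intro: mult_left_le)
        ultimately show ?thesis using t by simp
      qed
      moreover have "?v $ k \<noteq> u $ k"
        using k t by simp
      then have "?v \<noteq> u"
        by metis
      moreover have "dist ?v u < e"
        using t by (simp add: dist_norm n_def)
      ultimately show "\<exists>v\<in>?I. v \<noteq> u \<and> dist v u < e"
        by blast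
    qed
    then show ?thesis
      by (simp add: trivial_limit_within)
  qed
  ultimately have "Lim (at u within ?I) ?C = 0"
    by (intro tendsto_Lim)
  moreover have "\<not> (\<forall>i. u $ i > 0)"
    using k by (metis less_irrefl)
  ultimately show ?thesis
    unfolding archimax_copula_def Let_def by (simp only: if_False)
qed

section \<open>The distance of Archimax copulas\<close>

theorem mainTheorem8:
  fixes \<psi> :: "real \<Rightarrow> real"
    and F\<^sub>1 F\<^sub>2 :: "real ^ 'd \<Rightarrow> real"
    and V\<^sub>1 V\<^sub>2 :: "ereal ^ 'd \<Rightarrow> real"
    and M\<^sub>1 :: "'a measure" and M\<^sub>2 :: "'b measure"
    and Z\<^sub>1 :: "'a \<Rightarrow> real ^ 'd" and Z\<^sub>2 :: "'b \<Rightarrow> real ^ 'd"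
    and W\<^sub>1 W\<^sub>2 :: "real ^ 'd \<Rightarrow> real ^ 'd \<Rightarrow> real ^ 'd"
    and \<Psi>\<^sub>1 \<Psi>\<^sub>2 :: "'d \<Rightarrow> real ^ 'd \<Rightarrow> real"
  assumes "CARD('d) \<ge> 2"
    and "\<psi> \<in> {0..} \<rightarrow> {0<..1}"
    and "strict_archimedean_generator CARD('d) \<psi>"
    and "\<psi> C1_differentiable_on {0<..}"
    and "bdd_above ((\<lambda>t. t * \<bar>deriv \<psi> t\<bar>) ` {0<..})"
    and "max_stable_unit_frechet F\<^sub>1" and "max_stable_unit_frechet F\<^sub>2"
    and "\<And>x. (\<forall>i. x $ i > 0) \<Longrightarrow> F\<^sub>1 x = exp (- V\<^sub>1 (\<chi> i. ereal (x $ i)))"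
    and "\<And>x. (\<forall>i. x $ i > 0) \<Longrightarrow> F\<^sub>2 x = exp (- V\<^sub>2 (\<chi> i. ereal (x $ i)))"
    and "Psi_decomposition M\<^sub>1 Z\<^sub>1 W\<^sub>1 V\<^sub>1 \<Psi>\<^sub>1" and "Psi_decomposition M\<^sub>2 Z\<^sub>2 W\<^sub>2 V\<^sub>2 \<Psi>\<^sub>2"
  shows "kolmogorov_dist
           (archimax_copula \<psi> (stable_tail_dependence V\<^sub>1))
           (archimax_copula \<psi> (stable_tail_dependence V\<^sub>2))
         \<le> (SUP t \<in> {0<..}. t * \<bar>deriv \<psi> t\<bar>) *
           (SUP x \<in> {x. (\<forall>i. x $ i > 0) \<and> (MIN i. x $ i) = 1}.
              \<bar>\<Sum>i\<in>UNIV. 1 / x $ i * (\<Psi>\<^sub>1 i x - \<Psi>\<^sub>2 i x)\<bar>)"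
proof -
  let ?l\<^sub>1 = "stable_tail_dependence V\<^sub>1" and ?l\<^sub>2 = "stable_tail_dependence V\<^sub>2"
  define X where "X = {x :: real ^ 'd. (\<forall>i. x $ i > 0) \<and> (MIN i. x $ i) = 1}"
  define D where "D x = \<bar>\<Sum>i\<in>UNIV. 1 / x $ i * (\<Psi>\<^sub>1 i x - \<Psi>\<^sub>2 i x)\<bar>" for x
  define K where "K = (SUP t \<in> {0<..}. t * \<bar>deriv \<psi> t\<bar>)"
  define S where "S = (SUP x \<in> X. D x)"
  have rep\<^sub>1: "de_haan_representer M\<^sub>1 Z\<^sub>1 V\<^sub>1" and rep\<^sub>2: "de_haan_representer M\<^sub>2 Z\<^sub>2 V\<^sub>2"
    using assms(10,11) unfolding Psi_decomposition_def by auto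
  have D: "D x = \<bar>?l\<^sub>1 (\<chi> i. 1 / x $ i) - ?l\<^sub>2 (\<chi> i. 1 / x $ i)\<bar>" if "\<forall>i. x $ i > 0" for x
  proof -
    have "(\<Sum>i\<in>UNIV. 1 / x $ i * (\<Psi>\<^sub>1 i x - \<Psi>\<^sub>2 i x))
        = (\<Sum>i\<in>UNIV. 1 / x $ i * \<Psi>\<^sub>1 i x) - (\<Sum>i\<in>UNIV. 1 / x $ i * \<Psi>\<^sub>2 i x)"
      by (simp only: right_diff_distrib sum_subtractf)
    then show ?thesis
      unfolding D_def Psi_sum_eq_stable_tail_dependence[OF assms(10) that]
        Psi_sum_eq_stable_tail_dependence[OF assms(11) that] by simp
  qed
  \<comment> \<open>Real suprema are meaningful only over bounded sets; here both tail dependence functions take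
    values between \<open>0\<close> and the dimension.\<close>
  have bdd: "bdd_above (D ` X)"
  proof (rule bdd_aboveI2)
    fix x assume x: "x \<in> X"
    have x1: "1 / x $ i \<le> 1" and x0: "0 < x $ i" for i
    proof -
      have "(MIN i. x $ i) \<le> x $ i" by (intro Min_le) auto
      with x show "1 / x $ i \<le> 1" "0 < x $ i" by (auto simp: X_def)
    qed
    let ?z = "\<chi> i. 1 / x $ i"
    have z: "\<forall>i. ?z $ i \<ge> 0"
      using x0 less_imp_le by auto
    have "(\<Sum>i\<in>UNIV. ?z $ i) \<le> real CARD('d)"
      using sum_mono[of UNIV "\<lambda>i. ?z $ i" "\<lambda>_. 1"] x1 by simp
    moreover have "0 \<le> ?l\<^sub>1 ?z" "0 \<le> ?l\<^sub>2 ?z"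
      using stable_tail_dependence_ge_component[OF rep\<^sub>1 z]
        stable_tail_dependence_ge_component[OF rep\<^sub>2 z] z order_trans by blast+
    ultimately show "D x \<le> real CARD('d)"
      using D[of x] x0 stable_tail_dependence_le_sum[OF rep\<^sub>1 z]
        stable_tail_dependence_le_sum[OF rep\<^sub>2 z]
      by (simp add: abs_if)
  qed
  have K: "t * \<bar>deriv \<psi> t\<bar> \<le> K" if "t > 0" for t
    unfolding K_def using assms(5) that by (intro cSUP_upper) auto
  have "K \<ge> 0"
    using K[of 1] by simp
  have S: "D x \<le> S" if "x \<in> X" for x
    unfolding S_def using bdd that by (intro cSUP_upper)
  have "1 \<in> X"
    by (simp add: X_def)
  then have "S \<ge> 0"
    using S[of 1] by (simp add: D_def)
  have sphere: "\<bar>?l\<^sub>1 y - ?l\<^sub>2 y\<bar> \<le> S"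
    if y: "\<forall>i. y $ i > 0" and max: "(MAX i. y $ i) = 1" for y
  proof -
    let ?x = "\<chi> i. 1 / y $ i"
    have "(MIN i. ?x $ i) = 1"
    proof (rule Min_eqI)
      have yle: "y $ i \<le> 1" for i
        unfolding max[symmetric] by (intro Max_ge) auto
      then show "1 \<le> t" if t: "t \<in> range (\<lambda>i. ?x $ i)" for t
        using t y by auto
      have "(MAX i. y $ i) \<in> range (\<lambda>i. y $ i)"
        by (intro Max_in) auto
      then obtain i where "1 = y $ i"
        unfolding max by (rule rangeE)
      then show "1 \<in> range (\<lambda>i. ?x $ i)"
        by (intro image_eqI[of _ _ i]) auto
    qed simp
    with y have "?x \<in> X"
      by (simp add: X_def)
    from S[OF this] D[of ?x] y show ?thesis
      by simp
  qed
  have l_diff: "\<bar>?l\<^sub>1 z - ?l\<^sub>2 z\<bar> \<le> (MAX i. z $ i) * S" if "\<forall>i. z $ i \<ge> 0" for z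
    by (rule stable_tail_dependence_diff_le[OF rep\<^sub>1 rep\<^sub>2 sphere that])
  have diff: "\<psi> differentiable (at t)" if "t > 0" for t
    using assms(4) that by (simp add: C1_differentiable_on_eq)
  have "\<bar>archimax_copula \<psi> ?l\<^sub>1 u - archimax_copula \<psi> ?l\<^sub>2 u\<bar> \<le> K * S"
    if u: "\<forall>i. u $ i \<in> {0..1}" for u
  proof (cases "\<forall>i. u $ i > 0")
    case True
    define z where "z = (\<chi> i. the_inv_into {0..} \<psi> (u $ i))"
    have z: "\<forall>i. z $ i \<ge> 0"
      using True u bij_betwE[OF bij_betw_the_inv_into[OF
            strict_archimedean_generator_bij_betw[OF assms(3,2)]]]
      by (simp add: z_def)
    let ?m = "MAX i. z $ i"
    have m_le: "?m \<le> ?l\<^sub>1 z" "?m \<le> ?l\<^sub>2 z"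
      using stable_tail_dependence_ge_component[OF rep\<^sub>1 z]
        stable_tail_dependence_ge_component[OF rep\<^sub>2 z] by auto
    have "\<bar>\<psi> (?l\<^sub>1 z) - \<psi> (?l\<^sub>2 z)\<bar> \<le> K * S"
    proof (cases "?m > 0")
      case True
      then show ?thesis
        by (intro diff_le_of_scaled_deriv_bound[OF diff K _ m_le l_diff[OF z]])
    next
      case False
      have "z $ i = 0" for i
      proof -
        have "z $ i \<le> ?m"
          by (intro Max_ge) auto
        with False z[rule_format, of i] show ?thesis
          by linarith
      qed
      then have "z = 0"
        by (simp add: vec_eq_iff)
      then show ?thesis
        using \<open>K \<ge> 0\<close> \<open>S \<ge> 0\<close>
        by (simp add: stable_tail_dependence_zero[OF rep\<^sub>1] stable_tail_dependence_zero[OF rep\<^sub>2])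
    qed
    then show ?thesis
      using True by (simp add: archimax_copula_def z_def)
  next
    case False
    then obtain k where "\<not> u $ k > 0"
      by blast
    with u[rule_format, of k] have "u $ k = 0"
      by simp
    then have "archimax_copula \<psi> ?l\<^sub>1 u = 0" and "archimax_copula \<psi> ?l\<^sub>2 u = 0"
      using archimax_copula_eq_0[OF assms(3,2) stable_tail_dependence_ge_component[OF rep\<^sub>1] u]
        archimax_copula_eq_0[OF assms(3,2) stable_tail_dependence_ge_component[OF rep\<^sub>2] u]
      by simp_all
    then show ?thesis
      using \<open>K \<ge> 0\<close> \<open>S \<ge> 0\<close> by simp
  qed
  moreover have "{u :: real ^ 'd. \<forall>i. u $ i \<in> {0..1}} \<noteq> {}"
    by (rule ex_in_conv[THEN iffD1], rule exI[of _ 1]) simp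
  ultimately have "kolmogorov_dist (archimax_copula \<psi> ?l\<^sub>1) (archimax_copula \<psi> ?l\<^sub>2) \<le> K * S"
    unfolding kolmogorov_dist_def by (intro cSUP_least) blast+
  then show ?thesis
    unfolding K_def S_def D_def X_def .
qed

end
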